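(* In the two-layer network setting described in the context, let $\theta_0(\lambda)$ be an $S_m$-symmetric critical branch of $L$. Then at $\lambda=0$ the Hessian $H_0:=\nabla_\theta^2L(\theta_0(0),0)$ (with respect to $\theta=(W,v)$) has an $(m-1)$-dimensional kernel contribution from the standard representation of $S_m$. In particular, if $m\ge 2$, the kernel dimension of $H_0$ is at least $m-1$, and the simple-degeneracy assumption (simple degeneracy at an interior $\lambda^*$, stated in the context) fails at $\lambda=0$.
   Context: Two-layer network: $f(x;\theta,\lambda)=\sum_{j=1}^m v_j\,h(w_j^\top x,\lambda)$ with $h(z,\lambda)=(1-\lambda)z+\lambda\sigma(z)$, parameters $\theta=(W,v)$, $W=(w_1,\dots,w_m)^\top\in\mathbb R^{m\times d}$ (rows $w_j^\top$), $v\in\mathbb R^m$. The activation satisfies $\sigma\in C^4(\mathbb R)$, $\sigma(0)=0$, $\sigma'(0)=1$. For a data distribution $(x,y)\sim\mathcal D$ on $\mathbb R^d\times\mathbb R$, the loss is $L(\theta,\lambda)=\tfrac12\mathbb E[(f(x;\theta,\lambda)-y)^2]$; $L$ is assumed to be $C^k$ in $(\theta,\lambda)$ with $k\ge4$, for $\lambda$ in an open interval $I\supset[0,1]$. $S_m$ acts on parameter space by simultaneously permuting the rows of $W$ and the entries of $v$; this preserves $L(\cdot,\lambda)$ for all $\lambda$. A critical branch is a smooth map $\lambda\mapsto\theta_0(\lambda)=(W_0(\lambda),v_0(\lambda))$ with $\nabla_\theta L(\theta_0(\lambda),\lambda)=0$ for all $\lambda$. It is $S_m$-symmetric if it lies in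 the fixed-point subspace of the $S_m$-action: all rows of $W_0(\lambda)$ are equal and all entries of $v_0(\lambda)$ are equal. The standard representation of $S_m$ is the $(m-1)$-dimensional representation on $\{\epsilon\in\mathbb R^m:\sum_j\epsilon_j=0\}$; a kernel contribution from it means a subspace of the kernel isomorphic to it under the induced $S_m$-action on the tangent space. Simple-degeneracy assumption for a critical branch $\theta_0$: there exists $\lambda^*\in(0,1)$ such that the Hessian $\nabla^2_\theta L(\theta_0(\lambda^* ),\lambda^* )$ has a one-dimensional kernel.
   Formalization: The formal theorem excludes the case m ≥ 2, d = 1, θ_0(0) = 0 and E[yx] ≠ 0, where H_0 is invertible and the claim is false (e.g. σ = id, x = y = 1 almost surely, m = 2, θ_0 ≡ 0). *)

theory Defs
  imports "HOL-Probability.Probability"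
begin

section \<open>Calculus\<close>

text \<open>
  Continuous differentiability of order \<open>k\<close> on an open subset of a finite-dimensional space:
  all directional derivatives of a differentiable function are again of class one less.
\<close>

primrec Ck_on :: "nat \<Rightarrow> ('a::euclidean_space \<Rightarrow> 'b::real_normed_vector) \<Rightarrow> 'a set \<Rightarrow> bool" where
  "Ck_on 0 f S \<longleftrightarrow> continuous_on S f"
| "Ck_on (Suc k) f S \<longleftrightarrow>
     (\<forall>x\<in>S. f differentiable (at x)) \<and>
     (\<forall>u. Ck_on k (\<lambda>x. frechet_derivative f (at x) u) S)"

definition smooth_on :: "('a::euclidean_space \<Rightarrow> 'b::real_normed_vector) \<Rightarrow> 'a set \<Rightarrow> bool" where
  "smooth_on f S \<longleftrightarrow> (\<forall>k. Ck_on k f S)"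

definition gradient :: "('a::euclidean_space \<Rightarrow> real) \<Rightarrow> 'a \<Rightarrow> 'a" where
  "gradient f x = (THE g. GDERIV f x :> g)"

text \<open>The Hessian is the linear operator given by the derivative of the gradient field.\<close>

definition hessian :: "('a::euclidean_space \<Rightarrow> real) \<Rightarrow> 'a \<Rightarrow> 'a \<Rightarrow> 'a" where
  "hessian f x = frechet_derivative (gradient f) (at x)"

definition null_space :: "('a::euclidean_space \<Rightarrow> 'a) \<Rightarrow> 'a set" where
  "null_space A = {u. A u = 0}"

section \<open>The network and its loss\<close>

text \<open>
  The index types are \<open>'m\<close> for the hidden neurons and \<open>'d\<close> for the inputs; a parameter is
  \<open>\<theta> = (W, v)\<close>, and \<open>W $ j\<close> is the \<open>j\<close>-th row of \<open>W\<close>.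
\<close>

type_synonym ('d, 'm) params = "(real^'d^'m) \<times> (real^'m)"

definition activation :: "(real \<Rightarrow> real) \<Rightarrow> real \<Rightarrow> real \<Rightarrow> real" where
  "activation \<sigma> z l = (1 - l) * z + l * \<sigma> z"

definition network ::
    "(real \<Rightarrow> real) \<Rightarrow> ('d::finite, 'm::finite) params \<Rightarrow> real \<Rightarrow> real^'d \<Rightarrow> real" where
  "network \<sigma> \<theta> l x = (\<Sum>j\<in>UNIV. (snd \<theta> $ j) * activation \<sigma> ((fst \<theta> $ j) \<bullet> x) l)"

text \<open>
  The integral below has the value \<open>0\<close> on non-integrable functions, so that a finite expected
  squared error must be assumed separately.
\<close>

definition loss ::
    "(real \<Rightarrow> real) \<Rightarrow> ((real^'d::finite) \<times> real) measure \<Rightarrow> ('d, 'm::finite) params \<Rightarrow> real \<Rightarrow> real"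
  where "loss \<sigma> D \<theta> l = (1/2) * (\<integral>p. (network \<sigma> \<theta> l (fst p) - snd p)\<^sup>2 \<partial>D)"

section \<open>The symmetric group\<close>

text \<open>
  \<open>S_m\<close> consists of the \<open>\<pi>\<close> with \<open>\<pi> permutes UNIV\<close>. The inverse makes these left actions.
  The action on parameters is linear, so the induced action on tangent vectors is given by
  the same formula.
\<close>

definition perm_vec :: "('m::finite \<Rightarrow> 'm) \<Rightarrow> 'a^'m \<Rightarrow> 'a^'m" where
  "perm_vec \<pi> u = (\<chi> j. u $ (inv \<pi> j))"

definition perm_params ::
    "('m::finite \<Rightarrow> 'm) \<Rightarrow> ('d::finite, 'm) params \<Rightarrow> ('d, 'm) params" where
  "perm_params \<pi> \<theta> = (perm_vec \<pi> (fst \<theta>), perm_vec \<pi> (snd \<theta>))"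

definition standard_rep :: "(real^'m::finite) set" where
  "standard_rep = {\<epsilon>. (\<Sum>j\<in>UNIV. \<epsilon> $ j) = 0}"

text \<open>
  Invariance under a group and isomorphism of two invariant subspaces as representations
  (every linear map between subspaces extends linearly to the ambient space).
\<close>

definition perm_invariant :: "(('m::finite \<Rightarrow> 'm) \<Rightarrow> 'a \<Rightarrow> 'a) \<Rightarrow> 'a::real_vector set \<Rightarrow> bool" where
  "perm_invariant act V \<longleftrightarrow> (\<forall>\<pi>. \<pi> permutes UNIV \<longrightarrow> act \<pi> ` V \<subseteq> V)"

definition rep_isomorphic ::
    "(('m::finite \<Rightarrow> 'm) \<Rightarrow> 'a \<Rightarrow> 'a) \<Rightarrow> 'a::real_vector set \<Rightarrow>
     (('m \<Rightarrow> 'm) \<Rightarrow> 'b \<Rightarrow> 'b) \<Rightarrow> 'b::real_vector set \<Rightarrow> bool" where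
  "rep_isomorphic act1 V1 act2 V2 \<longleftrightarrow>
     (\<exists>T. linear T \<and> bij_betw T V1 V2 \<and>
          (\<forall>\<pi>. \<pi> permutes UNIV \<longrightarrow> (\<forall>u\<in>V1. T (act1 \<pi> u) = act2 \<pi> (T u))))"

section \<open>Critical branches\<close>

definition critical_branch ::
    "(('d::finite, 'm::finite) params \<Rightarrow> real \<Rightarrow> real) \<Rightarrow> real set \<Rightarrow>
     (real \<Rightarrow> ('d, 'm) params) \<Rightarrow> bool" where
  "critical_branch L I \<theta>0 \<longleftrightarrow>
     smooth_on \<theta>0 I \<and> (\<forall>l\<in>I. gradient (\<lambda>\<theta>. L \<theta> l) (\<theta>0 l) = 0)"

definition symmetric_branch ::
    "real set \<Rightarrow> (real \<Rightarrow> ('d::finite, 'm::finite) params) \<Rightarrow> bool" where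
  "symmetric_branch I \<theta>0 \<longleftrightarrow>
     (\<forall>l\<in>I. \<forall>\<pi>. \<pi> permutes UNIV \<longrightarrow> perm_params \<pi> (\<theta>0 l) = \<theta>0 l)"

text \<open>
  The simple-degeneracy assumption asks that this holds at some \<open>l\<close> in the open unit interval.
\<close>

definition simply_degenerate_at ::
    "(('d::finite, 'm::finite) params \<Rightarrow> real \<Rightarrow> real) \<Rightarrow>
     (real \<Rightarrow> ('d, 'm) params) \<Rightarrow> real \<Rightarrow> bool" where
  "simply_degenerate_at L \<theta>0 l \<longleftrightarrow> dim (null_space (hessian (\<lambda>\<theta>. L \<theta> l) (\<theta>0 l))) = 1"

end

theory Submission
  imports Defs
begin

text \<open>
  At \<open>\<lambda> = 0\<close> the network is the linear map \<open>x \<mapsto> a \<bullet> x\<close> with \<open>a = \<Sum>\<^sub>j v\<^sub>j w\<^sub>j\<close>, so the loss is a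
  quadratic polynomial \<open>Q\<close> evaluated at \<open>a\<close>. With \<open>g = \<nabla>Q(a)\<close>, criticality of a symmetric point
  (all \<open>w\<^sub>j = w\<close>, all \<open>v\<^sub>j = s\<close>) means \<open>s g = 0\<close> and \<open>w \<bullet> g = 0\<close>. A tangent vector
  \<open>(\<epsilon>\<^sub>j p)\<^sub>j\<close> in the \<open>W\<close>-direction with \<open>\<Sum>\<epsilon>\<^sub>j = 0\<close> does not move \<open>a\<close> to first order, and the
  Hessian maps it to \<open>(0, \<epsilon>\<^sub>j (p \<bullet> g))\<close>. Hence a copy of the standard representation lies in the
  kernel as soon as there is \<open>p \<noteq> 0\<close> orthogonal to \<open>g\<close>. This fails only for \<open>d = 1\<close>, \<open>g \<noteq> 0\<close>,
  and then \<open>w = 0\<close>, \<open>s = 0\<close> and \<open>g = - E[y x] \<noteq> 0\<close>, the exceptional case. The kernel is never one-dimensional: if \<open>g = 0\<close>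
  there is a second copy in the \<open>v\<close>-direction, and if \<open>g \<noteq> 0\<close> then \<open>s = 0\<close> and the condition
  \<open>\<Sum>\<epsilon>\<^sub>j = 0\<close> can be dropped.
\<close>

section \<open>Gradients and componentwise derivatives\<close>

lemma gradient_eqI:
  assumes "GDERIV f x :> g"
  shows "gradient f x = g"
  unfolding gradient_def
proof (rule the_equality)
  show "GDERIV f x :> g" by (rule assms)
next
  \<comment> \<open>\<open>gradient\<close> is a definite description, so uniqueness is required:
    two gradients have the same inner product with every vector.\<close>
  fix h assume "GDERIV f x :> h"
  with assms have "(\<lambda>u. u \<bullet> h) = (\<lambda>u. u \<bullet> g)"
    unfolding gderiv_def by (rule has_derivative_unique[rotated])
  then have "u \<bullet> h = u \<bullet> g" for u by (rule fun_cong)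
  then show "h = g" using vector_eq_ldot[of h g] by blast
qed

lemma has_derivative_vec_lambda:
  fixes f :: "'n::finite \<Rightarrow> 'a::euclidean_space \<Rightarrow> 'b::euclidean_space"
  assumes "\<And>i. (f i has_derivative f' i) (at x)"
  shows "((\<lambda>x. \<chi> i. f i x) has_derivative (\<lambda>u. \<chi> i. f' i u)) (at x)"
proof -
  have "((\<lambda>x. (\<chi> i. f i x) \<bullet> e) has_derivative (\<lambda>u. (\<chi> i. f' i u) \<bullet> e)) (at x)"
    if "e \<in> Basis" for e :: "'b^'n"
  proof -
    \<comment> \<open>Inner product with the basis vector \<open>axis i v\<close> sees only
      component \<open>i\<close>, which reduces the claim to the derivative of
      \<open>f i\<close>.\<close>
    obtain i v where "e = axis i v"
      using \<open>e \<in> Basis\<close> by (auto simp: Basis_vec_def)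
    then show ?thesis
      using has_derivative_inner_left[OF assms, of i v] by (simp add: inner_axis)
  qed
  then show ?thesis
    using has_derivative_componentwise_within[of "\<lambda>x. \<chi> i. f i x" "\<lambda>u. \<chi> i. f' i u" x UNIV] by simp
qed

section \<open>The linear network and derivatives through its coefficient vector\<close>

definition effective_weight :: "('d::finite, 'm::finite) params \<Rightarrow> real^'d" where
  "effective_weight \<theta> = (\<Sum>j\<in>UNIV. (snd \<theta> $ j) *\<^sub>R (fst \<theta> $ j))"

lemma network_at_zero: "network \<sigma> \<theta> 0 x = effective_weight \<theta> \<bullet> x"
  by (simp add: network_def activation_def effective_weight_def inner_sum_left)

lemma effective_weight_has_derivative:
  "(effective_weight has_derivative
     (\<lambda>u. \<Sum>j\<in>UNIV. (snd \<theta> $ j) *\<^sub>R (fst u $ j) + (snd u $ j) *\<^sub>R (fst \<theta> $ j))) (at \<theta>)"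
  unfolding effective_weight_def
  by (auto intro!: derivative_eq_intros bounded_linear.has_derivative[OF bounded_linear_vec_nth])

context
  fixes Q :: "real^'d::finite \<Rightarrow> real" and g S :: "real^'d \<Rightarrow> real^'d"
  assumes grad_Q: "\<And>a. GDERIV Q a :> g a"
    and deriv_g: "\<And>a. (g has_derivative S) (at a)"
begin

lemma gradient_effective:
  fixes \<theta> :: "('d, 'm::finite) params"
  shows "gradient (\<lambda>\<theta>. Q (effective_weight \<theta>)) \<theta> =
    (\<chi> j. (snd \<theta> $ j) *\<^sub>R g (effective_weight \<theta>), \<chi> j. (fst \<theta> $ j) \<bullet> g (effective_weight \<theta>))"
proof (rule gradient_eqI, unfold gderiv_def)
  have "((\<lambda>\<theta>. Q (effective_weight \<theta>)) has_derivative
      (\<lambda>u. (\<Sum>j\<in>UNIV. (snd \<theta> $ j) *\<^sub>R (fst u $ j) + (snd u $ j) *\<^sub>R (fst \<theta> $ j))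
         \<bullet> g (effective_weight \<theta>))) (at \<theta>)"
    by (rule has_derivative_compose[OF effective_weight_has_derivative grad_Q[unfolded gderiv_def]])
  then show "((\<lambda>\<theta>. Q (effective_weight \<theta>)) has_derivative
     (\<lambda>u. u \<bullet> (\<chi> j. (snd \<theta> $ j) *\<^sub>R g (effective_weight \<theta>),
               \<chi> j. (fst \<theta> $ j) \<bullet> g (effective_weight \<theta>)))) (at \<theta>)"
    by (rule has_derivative_eq_rhs)
      (simp add: inner_prod_def inner_vec_def[where 'a = "real^'d"]
        inner_vec_def[where 'a = real and 'b = 'm] inner_sum_left inner_add_left sum.distrib)
qed

text \<open>Product rule on the gradient field. The \<open>S \<delta>\<close> terms come from moving
  the effective weight, where \<open>S\<close> is the same at every point since \<open>Q\<close> is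
  quadratic. The \<open>g a\<close> terms come from the bilinearity of
  \<open>effective_weight\<close> in \<open>W\<close> and \<open>v\<close>; they alone survive when
  \<open>\<delta> = 0\<close>.\<close>

lemma hessian_effective:
  fixes \<theta> u :: "('d, 'm::finite) params"
  defines "a \<equiv> effective_weight \<theta>"
    and "\<delta> \<equiv> \<Sum>j\<in>UNIV. (snd \<theta> $ j) *\<^sub>R (fst u $ j) + (snd u $ j) *\<^sub>R (fst \<theta> $ j)"
  shows "hessian (\<lambda>\<theta>. Q (effective_weight \<theta>)) \<theta> u =
    (\<chi> j. (snd \<theta> $ j) *\<^sub>R S \<delta> + (snd u $ j) *\<^sub>R g a, \<chi> j. (fst \<theta> $ j) \<bullet> S \<delta> + (fst u $ j) \<bullet> g a)"
proof -
  let ?d = "\<lambda>u. \<Sum>j\<in>UNIV. (snd \<theta> $ j) *\<^sub>R (fst u $ j) + (snd u $ j) *\<^sub>R (fst \<theta> $ j)"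
  let ?G = "\<lambda>\<theta> :: ('d, 'm) params. (\<chi> j. (snd \<theta> $ j) *\<^sub>R g (effective_weight \<theta>),
    \<chi> j. (fst \<theta> $ j) \<bullet> g (effective_weight \<theta>))"
  let ?D = "\<lambda>u. (\<chi> j. (snd \<theta> $ j) *\<^sub>R S (?d u) + (snd u $ j) *\<^sub>R g a,
    \<chi> j. (fst \<theta> $ j) \<bullet> S (?d u) + (fst u $ j) \<bullet> g a)"
  have g: "((\<lambda>\<theta>. g (effective_weight \<theta>)) has_derivative (\<lambda>u. S (?d u))) (at \<theta>)"
    by (rule has_derivative_compose[OF effective_weight_has_derivative deriv_g])
  have v: "((\<lambda>\<theta> :: ('d, 'm) params. snd \<theta> $ j) has_derivative (\<lambda>u. snd u $ j)) (at \<theta>)" for j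
    by (intro bounded_linear_imp_has_derivative bounded_linear_compose[OF bounded_linear_vec_nth]
        bounded_linear_snd)
  have w: "((\<lambda>\<theta> :: ('d, 'm) params. fst \<theta> $ j) has_derivative (\<lambda>u. fst u $ j)) (at \<theta>)" for j
    by (intro bounded_linear_imp_has_derivative bounded_linear_compose[OF bounded_linear_vec_nth]
        bounded_linear_fst)
  have "(?G has_derivative ?D) (at \<theta>)"
    unfolding a_def
    by (intro has_derivative_Pair has_derivative_vec_lambda has_derivative_scaleR[OF v g]
        has_derivative_inner[OF w g])
  then have "hessian (\<lambda>\<theta>. Q (effective_weight \<theta>)) \<theta> = ?D"
    unfolding hessian_def gradient_effective[abs_def] by (rule frechet_derivative_at[symmetric])
  then show ?thesis by (simp add: \<delta>_def)
qed

end

section \<open>The squared loss of a linear predictor\<close>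

lemma quadratic_gderiv:
  fixes S :: "'a::euclidean_space \<Rightarrow> 'a"
  assumes "linear S" and sym: "\<And>a u. S a \<bullet> u = a \<bullet> S u"
  shows "GDERIV (\<lambda>a. (1/2) * (a \<bullet> S a) - a \<bullet> b + c) a :> S a - b"
proof -
  have "(S has_derivative S) (at a)"
    using assms(1) by (rule linear_imp_has_derivative)
  then have "((\<lambda>a. (1/2) * (a \<bullet> S a) - a \<bullet> b + c) has_derivative
      (\<lambda>u. (1/2) * (a \<bullet> S u + u \<bullet> S a) - u \<bullet> b)) (at a)"
    by (auto intro!: derivative_eq_intros)
  \<comment> \<open>Symmetry merges the two halves of the derivative, which cancels the factor
    \<open>1/2\<close>.\<close>
  moreover have "a \<bullet> S u = u \<bullet> S a" for u
    using sym[of a u] by (simp add: inner_commute)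
  ultimately show ?thesis
    by (simp add: gderiv_def inner_diff_right)
qed

text \<open>Expand the square: \<open>S\<close> is the second-moment operator of \<open>x\<close>
  and \<open>c\<close> is half the second moment of \<open>y\<close>. Splitting the integral needs
  all second moments to be finite, which follows from finite loss at every \<open>a\<close>.\<close>

lemma square_loss_quadratic:
  fixes D :: "((real^'d::finite) \<times> real) measure"
  assumes sets_D: "sets D = sets borel"
    and int: "\<And>a. integrable D (\<lambda>p. (a \<bullet> fst p - snd p)\<^sup>2)"
  obtains S c where "linear S" "\<And>a u. S a \<bullet> u = a \<bullet> S u"
    "\<And>a. (1/2) * (\<integral>p. (a \<bullet> fst p - snd p)\<^sup>2 \<partial>D) =
       (1/2) * (a \<bullet> S a) - a \<bullet> (\<integral>p. snd p *\<^sub>R fst p \<partial>D) + c"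
proof -
  have meas: "f \<in> borel_measurable D" if "continuous_on UNIV f"
    for f :: "(real^'d) \<times> real \<Rightarrow> 'b::topological_space"
    using borel_measurable_continuous_onI[OF that] measurable_cong_sets[OF sets_D refl] by blast
  have y2: "integrable D (\<lambda>p. (snd p)\<^sup>2)"
    using int[of 0] by simp
  have ax2: "integrable D (\<lambda>p. (a \<bullet> fst p)\<^sup>2)" for a
  proof (rule Bochner_Integration.integrable_bound)
    show "integrable D (\<lambda>p. 2 * ((a \<bullet> fst p - snd p)\<^sup>2 + (snd p)\<^sup>2))"
      using int y2 by simp
    \<comment> \<open>The right side minus the left side is the square of
      \<open>a \<bullet> x - 2 * y\<close>.\<close>
    have "(a \<bullet> x)\<^sup>2 \<le> 2 * ((a \<bullet> x - y)\<^sup>2 + y\<^sup>2)" for x and y :: real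
      using zero_le_power2[of "a \<bullet> x - 2 * y"] by (simp add: power2_eq_square algebra_simps)
    then show "AE p in D. norm ((a \<bullet> fst p)\<^sup>2) \<le> norm (2 * ((a \<bullet> fst p - snd p)\<^sup>2 + (snd p)\<^sup>2))"
      by simp
  qed (intro meas continuous_intros)
  have x2: "integrable D (\<lambda>p. (norm (fst p))\<^sup>2)"
  proof -
    have "(norm x)\<^sup>2 = (\<Sum>e\<in>Basis. (e \<bullet> x)\<^sup>2)" for x :: "real^'d"
      unfolding power2_norm_eq_inner
      by (subst euclidean_inner) (simp only: power2_eq_square inner_commute)
    then show ?thesis using ax2 by simp
  qed
  have xx: "integrable D (\<lambda>p. (a \<bullet> fst p) *\<^sub>R fst p)" for a
  proof (rule Bochner_Integration.integrable_bound)
    show "integrable D (\<lambda>p. norm a * (norm (fst p))\<^sup>2)"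
      using x2 by simp
    have "\<bar>a \<bullet> x\<bar> * norm x \<le> norm a * (norm x)\<^sup>2" for x
      using mult_right_mono[OF Cauchy_Schwarz_ineq2[of a x] norm_ge_zero[of x]]
      by (simp add: power2_eq_square mult.assoc)
    then show "AE p in D. norm ((a \<bullet> fst p) *\<^sub>R fst p) \<le> norm (norm a * (norm (fst p))\<^sup>2)"
      by simp
  qed (intro meas continuous_intros)
  have yx: "integrable D (\<lambda>p. snd p *\<^sub>R fst p)"
  proof (rule Bochner_Integration.integrable_bound)
    show "integrable D (\<lambda>p. (snd p)\<^sup>2 + (norm (fst p))\<^sup>2)"
      using x2 y2 by simp
    have "\<bar>y\<bar> * r \<le> y\<^sup>2 + r\<^sup>2" for y r :: real
      using zero_le_power2[of "\<bar>y\<bar> - r"] zero_le_power2[of y] zero_le_power2[of r]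
      unfolding power2_diff power2_abs by linarith
    then show "AE p in D. norm (snd p *\<^sub>R fst p) \<le> norm ((snd p)\<^sup>2 + (norm (fst p))\<^sup>2)"
      by simp
  qed (intro meas continuous_intros)
  define S where "S = (\<lambda>a. \<integral>p. (a \<bullet> fst p) *\<^sub>R fst p \<partial>D)"
  have lin: "linear S"
    unfolding S_def using xx
    by (intro linearI) (simp_all add: inner_add_left scaleR_add_left flip: scaleR_scaleR)
  have S_inner: "u \<bullet> S a = (\<integral>p. (a \<bullet> fst p) * (u \<bullet> fst p) \<partial>D)" for a u
    unfolding S_def using integral_inner_right[OF xx, of u a] by simp
  have sym: "S a \<bullet> u = a \<bullet> S u" for a u
    using S_inner by (simp add: inner_commute[of "S a"] mult.commute)
  define c where "c = (1/2) * (\<integral>p. (snd p)\<^sup>2 \<partial>D)"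
  have "(1/2) * (\<integral>p. (a \<bullet> fst p - snd p)\<^sup>2 \<partial>D) =
      (1/2) * (a \<bullet> S a) - a \<bullet> (\<integral>p. snd p *\<^sub>R fst p \<partial>D) + c" for a
  proof -
    have cross: "integrable D (\<lambda>p. a \<bullet> (snd p *\<^sub>R fst p))"
      by (rule integrable_inner_right) (rule yx)
    have "(\<integral>p. (a \<bullet> fst p - snd p)\<^sup>2 \<partial>D) =
        (\<integral>p. (a \<bullet> fst p)\<^sup>2 - 2 * (a \<bullet> (snd p *\<^sub>R fst p)) + (snd p)\<^sup>2 \<partial>D)"
      by (rule Bochner_Integration.integral_cong) (simp_all add: power2_diff mult_ac)
    also have "\<dots> = (\<integral>p. (a \<bullet> fst p)\<^sup>2 \<partial>D) - 2 * (\<integral>p. a \<bullet> (snd p *\<^sub>R fst p) \<partial>D)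
        + (\<integral>p. (snd p)\<^sup>2 \<partial>D)"
      using ax2 cross y2 by simp
    also have "(\<integral>p. (a \<bullet> fst p)\<^sup>2 \<partial>D) = a \<bullet> S a"
      by (simp add: S_inner power2_eq_square)
    also have "(\<integral>p. a \<bullet> (snd p *\<^sub>R fst p) \<partial>D) = a \<bullet> (\<integral>p. snd p *\<^sub>R fst p \<partial>D)"
      by (rule integral_inner_right) (rule yx)
    finally show ?thesis by (simp add: c_def algebra_simps)
  qed
  with lin sym show ?thesis by (rule that)
qed

text \<open>Finite loss on parameters transfers to all linear predictors because every
  \<open>a\<close> is an effective weight: give all neurons the row \<open>a\<close> and let exactly
  one of them have output weight 1.\<close>

lemma loss_at_zero:
  fixes D :: "((real^'d::finite) \<times> real) measure"
  assumes "sets D = sets borel"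
    and "\<And>\<theta> :: ('d, 'm::finite) params. integrable D (\<lambda>p. (network \<sigma> \<theta> 0 (fst p) - snd p)\<^sup>2)"
  obtains S :: "real^'d \<Rightarrow> real^'d" and c where "linear S" "\<And>a u. S a \<bullet> u = a \<bullet> S u"
    "\<And>\<theta> :: ('d, 'm) params. loss \<sigma> D \<theta> 0 =
       (1/2) * (effective_weight \<theta> \<bullet> S (effective_weight \<theta>))
       - effective_weight \<theta> \<bullet> (\<integral>p. snd p *\<^sub>R fst p \<partial>D) + c"
proof -
  have "integrable D (\<lambda>p. (a \<bullet> fst p - snd p)\<^sup>2)" for a
  proof -
    fix i :: 'm
    have "effective_weight (\<chi> j. a, axis i 1 :: real^'m) = a"
      by (simp add: effective_weight_def axis_def if_distrib[where f = "\<lambda>t. t *\<^sub>R a"] cong: if_cong)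
    then show ?thesis
      using assms(2)[of "(\<chi> j. a, axis i 1)"] by (simp add: network_at_zero)
  qed
  then obtain S :: "real^'d \<Rightarrow> real^'d" and c where S: "linear S" "\<And>a u. S a \<bullet> u = a \<bullet> S u"
    and quad: "\<And>a. (1/2) * (\<integral>p. (a \<bullet> fst p - snd p)\<^sup>2 \<partial>D) =
       (1/2) * (a \<bullet> S a) - a \<bullet> (\<integral>p. snd p *\<^sub>R fst p \<partial>D) + c"
    by (rule square_loss_quadratic[OF assms(1)]) blast
  show ?thesis
    by (rule that[OF S]) (unfold loss_def network_at_zero, rule quad)
qed

section \<open>The standard representation and its copies in parameter space\<close>

lemma perm_fixed_vec_const:
  assumes "\<And>\<pi>. \<pi> permutes UNIV \<Longrightarrow> perm_vec \<pi> u = u"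
  shows "u $ i = u $ j"
proof -
  have "perm_vec (Transposition.transpose i j) u $ i = u $ i"
    using assms[of "Transposition.transpose i j"] by (simp add: permutes_swap_id)
  then show ?thesis by (simp add: perm_vec_def)
qed

lemma standard_rep_hyperplane: "standard_rep = {\<epsilon>::real^'m::finite. (\<chi> j. 1) \<bullet> \<epsilon> = 0}"
  by (simp add: standard_rep_def inner_vec_def)

lemma subspace_standard_rep: "subspace standard_rep"
  unfolding standard_rep_hyperplane by (rule subspace_hyperplane)

lemma dim_standard_rep: "dim (standard_rep :: (real^'m::finite) set) = CARD('m) - 1"
proof -
  have "(\<chi> j. 1 :: real^'m) \<noteq> 0" by (simp add: vec_eq_iff)
  then show ?thesis unfolding standard_rep_hyperplane
    by (subst dim_hyperplane) auto
qed

lemma perm_vec_standard_rep: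
  assumes "\<pi> permutes UNIV" and "\<epsilon> \<in> standard_rep"
  shows "perm_vec \<pi> \<epsilon> \<in> standard_rep"
  using assms(2) sum.permute[OF permutes_inv[OF assms(1)], of "\<lambda>j. \<epsilon> $ j"]
  by (simp add: standard_rep_def perm_vec_def o_def)

lemma orthogonal_pair_dim_ge_2:
  fixes a b :: "'a::euclidean_space"
  assumes "a \<in> U" "b \<in> U" "a \<noteq> 0" "b \<noteq> 0" "a \<bullet> b = 0"
  shows "2 \<le> dim U"
proof -
  have "a \<noteq> b" using assms by auto
  moreover have "independent {a, b}"
    by (rule pairwise_orthogonal_independent)
      (use assms in \<open>auto simp: pairwise_def orthogonal_def inner_commute\<close>)
  ultimately show ?thesis
    using independent_card_le_dim[of "{a, b}" U] assms by simp
qed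

text \<open>The tensor of \<open>\<epsilon>\<close> and \<open>p\<close>, placed in the
  \<open>W\<close> factor. Permutations act on the neuron index only, so for fixed \<open>p\<close>
  this map is equivariant, and for \<open>p \<noteq> 0\<close> it embeds the standard
  representation.\<close>

definition row_direction :: "real^'d::finite \<Rightarrow> real^'m::finite \<Rightarrow> ('d, 'm) params" where
  "row_direction p \<epsilon> = (\<chi> j. (\<epsilon> $ j) *\<^sub>R p, 0)"

lemma linear_row_direction: "linear (row_direction p)"
  by (rule linearI) (simp_all add: row_direction_def vec_eq_iff scaleR_add_left)

lemma row_direction_eq_0_iff: "p \<noteq> 0 \<Longrightarrow> row_direction p \<epsilon> = 0 \<longleftrightarrow> \<epsilon> = 0"
  by (auto simp: row_direction_def vec_eq_iff zero_prod_def)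

lemma inj_row_direction: "p \<noteq> 0 \<Longrightarrow> inj (row_direction p)"
  using linear_injective_0[OF linear_row_direction] row_direction_eq_0_iff by metis

lemma row_direction_inner:
  fixes p :: "real^'d::finite" and a b :: "real^'m::finite"
  shows "row_direction p a \<bullet> row_direction p b = (a \<bullet> b) * (p \<bullet> p)"
  by (simp add: row_direction_def inner_vec_def[where 'a = "real^'d"] inner_vec_def[of a b]
      sum_distrib_left mult_ac)

lemma perm_row_direction: "perm_params \<pi> (row_direction p \<epsilon>) = row_direction p (perm_vec \<pi> \<epsilon>)"
  by (simp add: row_direction_def perm_params_def perm_vec_def vec_eq_iff)

lemma row_direction_copy_of_standard_rep:
  fixes p :: "real^'d::finite"
  assumes "p \<noteq> 0"
  defines "V \<equiv> row_direction p ` (standard_rep :: (real^'m::finite) set)"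
  shows "subspace V" "dim V = CARD('m) - 1" "perm_invariant perm_params V"
    "rep_isomorphic perm_vec (standard_rep :: (real^'m) set) perm_params V"
proof -
  show "subspace V"
    unfolding V_def by (intro linear_subspace_image linear_row_direction subspace_standard_rep)
  show "dim V = CARD('m) - 1"
    unfolding V_def
    by (simp add: dim_image_eq[OF linear_row_direction] dim_standard_rep
        inj_on_subset[OF inj_row_direction[OF assms(1)]])
  show "perm_invariant perm_params V"
    unfolding perm_invariant_def V_def
    by (auto simp: perm_row_direction intro: perm_vec_standard_rep)
  show "rep_isomorphic perm_vec (standard_rep :: (real^'m) set) perm_params V"
    unfolding rep_isomorphic_def V_def
    by (intro exI[of _ "row_direction p"] conjI linear_row_direction inj_on_imp_bij_betw
        inj_on_subset[OF inj_row_direction[OF assms(1)]]) (simp_all add: perm_row_direction)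
qed

section \<open>The kernel at a symmetric critical point\<close>

text \<open>The hypothesis \<open>not_exceptional\<close> excludes a genuine counterexample. At the
  zero parameter with one input and nonzero mean of \<open>y x\<close>, the Hessian swaps the
  \<open>W\<close> and \<open>v\<close> directions up to a nonzero factor, so its kernel is trivial
  although the standard representation is not when there are at least two neurons.\<close>

theorem proposition7p2:
  fixes \<sigma> :: "real \<Rightarrow> real"
    and D :: "((real^'d::finite) \<times> real) measure"
    and I :: "real set" and k :: nat
    and \<theta>0 :: "real \<Rightarrow> ('d, 'm::finite) params"
  defines "L \<equiv> (loss \<sigma> D :: ('d, 'm) params \<Rightarrow> real \<Rightarrow> real)"
  defines "H0 \<equiv> hessian (\<lambda>\<theta>. L \<theta> 0) (\<theta>0 0)"
  assumes sigma: "Ck_on 4 \<sigma> UNIV" "\<sigma> 0 = 0" "deriv \<sigma> 0 = 1"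
    and D: "prob_space D" "sets D = sets borel"
    and I: "open I" "is_interval I" "{0..1} \<subseteq> I"
    and finite_loss: "\<And>(\<theta> :: ('d, 'm) params) l. l \<in> I \<Longrightarrow>
           integrable D (\<lambda>p. (network \<sigma> \<theta> l (fst p) - snd p)\<^sup>2)"
    and L_Ck: "k \<ge> 4" "Ck_on k (\<lambda>(\<theta>, l). L \<theta> l) (UNIV \<times> I)"
    and branch: "critical_branch L I \<theta>0" "symmetric_branch I \<theta>0"
    and not_exceptional:
      "\<not> (CARD('m) \<ge> 2 \<and> CARD('d) = 1 \<and> \<theta>0 0 = 0 \<and> (\<integral>p. snd p *\<^sub>R fst p \<partial>D) \<noteq> 0)"
  shows "(\<exists>V. subspace V \<and> V \<subseteq> null_space H0 \<and> perm_invariant perm_params V \<and>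
              dim V = CARD('m) - 1 \<and>
              rep_isomorphic perm_vec (standard_rep :: (real^'m) set) perm_params V)
       \<and> (CARD('m) \<ge> 2 \<longrightarrow>
            dim (null_space H0) \<ge> CARD('m) - 1 \<and> \<not> simply_degenerate_at L \<theta>0 0)"
proof -
  have zero: "0 \<in> I" using I(3) by auto
  define b where "b = (\<integral>p. snd p *\<^sub>R fst p \<partial>D)"
  obtain S :: "real^'d \<Rightarrow> real^'d" and c where S: "linear S" "\<And>a u. S a \<bullet> u = a \<bullet> S u"
    and L0: "\<And>\<theta>. L \<theta> 0 = (1/2) * (effective_weight \<theta> \<bullet> S (effective_weight \<theta>))
        - effective_weight \<theta> \<bullet> b + c"
    unfolding L_def b_def by (rule loss_at_zero[OF D(2) finite_loss[OF zero]]) blast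
  define g where "g = S (effective_weight (\<theta>0 0)) - b"
  \<comment> \<open>\<open>undefined\<close> serves as an arbitrary neuron index; symmetry makes the
    choice immaterial.\<close>
  define w s where "w = fst (\<theta>0 0) $ undefined" and "s = snd (\<theta>0 0) $ undefined"
  have "perm_params \<pi> (\<theta>0 0) = \<theta>0 0" if "\<pi> permutes UNIV" for \<pi>
    using branch(2) zero that unfolding symmetric_branch_def by blast
  then have fixed: "perm_vec \<pi> (fst (\<theta>0 0)) = fst (\<theta>0 0)" "perm_vec \<pi> (snd (\<theta>0 0)) = snd (\<theta>0 0)"
    if "\<pi> permutes UNIV" for \<pi>
    using that unfolding perm_params_def by (metis fst_conv snd_conv)+
  have ws: "fst (\<theta>0 0) $ j = w" "snd (\<theta>0 0) $ j = s" for j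
    unfolding w_def s_def by (intro perm_fixed_vec_const fixed; assumption)+
  have grad: "GDERIV (\<lambda>a. (1/2) * (a \<bullet> S a) - a \<bullet> b + c) a :> S a - b" for a
    by (rule quadratic_gderiv[OF S])
  have deriv: "((\<lambda>a. S a - b) has_derivative S) (at a)" for a
    using linear_imp_has_derivative[OF S(1)] by (auto intro!: derivative_eq_intros)
  have "gradient (\<lambda>\<theta>. L \<theta> 0) (\<theta>0 0) = 0"
    using branch(1) zero unfolding critical_branch_def by blast
  then have "(\<chi> j::'m. s *\<^sub>R g, \<chi> j::'m. w \<bullet> g) = 0"
    unfolding L0 gradient_effective[OF grad deriv] ws g_def .
  then have crit: "s *\<^sub>R g = 0" "w \<bullet> g = 0"
    by (auto simp: zero_prod_def vec_eq_iff)
  \<comment> \<open>A sufficient condition read off from \<open>hessian_effective\<close>: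
    \<open>sums\<close> says that the effective weight is stationary to first order, and
    \<open>comps\<close> removes the remaining terms in \<open>g\<close>.\<close>
  have ker: "u \<in> null_space H0"
    if sums: "s *\<^sub>R (\<Sum>j\<in>UNIV. fst u $ j) + (\<Sum>j\<in>UNIV. snd u $ j) *\<^sub>R w = 0"
      and comps: "\<And>j. (snd u $ j) *\<^sub>R g = 0" "\<And>j. (fst u $ j) \<bullet> g = 0" for u
  proof -
    have "(\<Sum>j\<in>UNIV. s *\<^sub>R (fst u $ j) + (snd u $ j) *\<^sub>R w) = 0"
      using sums by (simp only: sum.distrib scaleR_sum_left scaleR_sum_right)
    then have "H0 u = (\<chi> j. s *\<^sub>R S 0 + (snd u $ j) *\<^sub>R g, \<chi> j. w \<bullet> S 0 + (fst u $ j) \<bullet> g)"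
      unfolding H0_def L0 hessian_effective[OF grad deriv] ws g_def by simp
    also have "\<dots> = 0"
      by (simp only: comps linear_0[OF S(1)]) (simp add: zero_prod_def vec_eq_iff)
    finally show ?thesis by (simp add: null_space_def)
  qed
  have ker_row: "row_direction p \<epsilon> \<in> null_space H0"
    if "p \<bullet> g = 0" "s = 0 \<or> \<epsilon> \<in> standard_rep" for p \<epsilon>
  proof (rule ker)
    have "s *\<^sub>R (\<Sum>j\<in>UNIV. (\<epsilon> $ j) *\<^sub>R p) = 0"
      using that(2) by (auto simp: standard_rep_def simp flip: scaleR_sum_left)
    then show "s *\<^sub>R (\<Sum>j\<in>UNIV. fst (row_direction p \<epsilon>) $ j)
        + (\<Sum>j\<in>UNIV. snd (row_direction p \<epsilon>) $ j) *\<^sub>R w = 0"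
      by (simp add: row_direction_def del: scaleR_eq_0_iff)
  qed (simp_all add: row_direction_def that(1))
  have ker_v: "(0, \<epsilon>) \<in> null_space H0" if "g = 0" "\<epsilon> \<in> standard_rep" for \<epsilon>
    using that by (intro ker) (simp_all add: standard_rep_def)
  have ortho: "\<exists>p. p \<noteq> 0 \<and> p \<bullet> g = 0" if m: "CARD('m) \<ge> 2"
  proof (cases "g = 0")
    case True
    have "(1 :: real^'d) \<noteq> 0" by (simp add: vec_eq_iff)
    then show ?thesis using True by (intro exI[of _ 1]) simp
  next
    case False
    \<comment> \<open>In one dimension a nonzero \<open>g\<close> forces \<open>w = 0\<close> and
      \<open>s = 0\<close> by criticality, which is the excluded case.\<close>
    have "CARD('d) \<noteq> 1"
    proof
      assume d: "CARD('d) = 1"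
      then obtain i :: 'd where i: "UNIV = {i}" by (auto simp: card_1_singleton_iff)
      have coord: "u = 0 \<longleftrightarrow> u $ i = 0" for u :: "real^'d"
      proof -
        have "j = i" for j using UNIV_I[of j] unfolding i by (rule singletonD)
        then show ?thesis by (metis vec_eq_iff zero_index)
      qed
      have "w $ i * g $ i = 0" using crit(2) by (simp add: inner_vec_def i)
      then have "w = 0" using False coord by simp
      moreover have "s = 0" using crit(1) False by simp
      ultimately have th: "\<theta>0 0 = 0" using ws by (simp add: prod_eq_iff vec_eq_iff)
      then have "g = - b" by (simp add: g_def effective_weight_def linear_0[OF S(1)])
      with False th d m not_exceptional show False by (simp add: b_def)
    qed
    moreover have "0 < CARD('d)" by simp
    ultimately have "2 \<le> CARD('d)" by linarith
    then have "2 \<le> DIM(real^'d)" by simp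
    then obtain p where "p \<noteq> 0" "orthogonal g p"
      using orthogonal_to_vector_exists by metis
    then show ?thesis by (auto simp: orthogonal_def inner_commute)
  qed
  have "\<exists>p. p \<noteq> 0 \<and> row_direction p ` (standard_rep :: (real^'m) set) \<subseteq> null_space H0"
  proof (cases "CARD('m) \<ge> 2")
    case True
    then show ?thesis using ortho ker_row by blast
  next
    case False
    \<comment> \<open>With a single neuron the standard representation is zero, so any nonzero
      \<open>p\<close> serves, here the all-ones vector.\<close>
    then have "dim (standard_rep :: (real^'m) set) = 0" by (simp add: dim_standard_rep)
    then have "(standard_rep :: (real^'m) set) \<subseteq> {0}" by simp
    moreover have "row_direction 1 (0 :: real^'m) \<in> null_space H0"
      by (rule ker) (simp_all add: row_direction_def)
    ultimately show ?thesis by (intro exI[of _ 1]) (auto simp: vec_eq_iff)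
  qed
  then obtain p where "p \<noteq> 0"
    and V: "row_direction p ` (standard_rep :: (real^'m) set) \<subseteq> null_space H0" by blast
  note copy = row_direction_copy_of_standard_rep[OF \<open>p \<noteq> 0\<close>, where 'm = 'm]
  \<comment> \<open>For two neurons the bound \<open>CARD('m) - 1\<close> is only 1 and would still
    allow simple degeneracy, so two independent kernel vectors are exhibited separately.\<close>
  have "2 \<le> dim (null_space H0)" if m: "CARD('m) \<ge> 2"
  proof -
    obtain i j :: 'm where ij: "i \<noteq> j"
      using m card_le_Suc0_iff_eq[of "UNIV :: 'm set"] by fastforce
    define \<epsilon> :: "real^'m" where "\<epsilon> = axis i 1 - axis j 1"
    have e: "\<epsilon> \<in> standard_rep"
      by (simp add: \<epsilon>_def standard_rep_def sum_subtractf axis_def)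
    have e0: "\<epsilon> \<noteq> 0" using ij by (auto simp: \<epsilon>_def axis_eq_axis)
    obtain q where q: "q \<noteq> 0" "q \<bullet> g = 0" using ortho[OF m] by blast
    show ?thesis
    proof (cases "g = 0")
      case True
      \<comment> \<open>One kernel vector lies in the \<open>W\<close> factor and one in the
        \<open>v\<close> factor, hence they are orthogonal.\<close>
      have "row_direction q \<epsilon> \<bullet> (0, \<epsilon>) = 0" by (simp add: row_direction_def)
      moreover have "row_direction q \<epsilon> \<noteq> 0" using row_direction_eq_0_iff[OF q(1)] e0 by blast
      moreover have "(0, \<epsilon>) \<noteq> (0 :: ('d, 'm) params)" using e0 by (simp add: zero_prod_def)
      ultimately show ?thesis
        using orthogonal_pair_dim_ge_2[OF ker_row[OF q(2) disjI2[OF e]] ker_v[OF True e]] by blast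
    next
      case False
      then have s: "s = 0" using crit(1) by simp
      \<comment> \<open>With \<open>s = 0\<close> each row may move along \<open>q\<close> on its
        own, so two different neurons give two orthogonal kernel vectors.\<close>
      have "row_direction q (axis i 1) \<bullet> row_direction q (axis j 1) = 0"
        using ij by (simp add: row_direction_inner inner_axis_axis)
      moreover have "row_direction q (axis l 1) \<noteq> 0" for l :: 'm
        using row_direction_eq_0_iff[OF q(1)] by (metis axis_eq_0_iff zero_neq_one)
      ultimately show ?thesis
        using orthogonal_pair_dim_ge_2[OF ker_row[OF q(2) disjI1[OF s]] ker_row[OF q(2) disjI1[OF s]]]
        by blast
    qed
  qed
  then have "\<not> simply_degenerate_at L \<theta>0 0" if "CARD('m) \<ge> 2"
    using that unfolding simply_degenerate_at_def H0_def by fastforce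
  moreover have "CARD('m) - 1 \<le> dim (null_space H0)"
    using dim_subset[OF V] copy(2) by simp
  ultimately show ?thesis using copy V by blast
qed

end
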